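(* Let $n\ge1$ and let $\nu,\mu\in\mathbb{R}$ with $\mu>0$. For every complex-valued $\mathcal{C}^\infty$ function $f$ on $\mathbb{C}^n$, $$\Delta_{\nu,\mu}f=-(d+\operatorname{ext}\theta_{\nu,\mu})^{*}(d+\operatorname{ext}\theta_{\nu,\mu})f.$$
   Context: $\Delta_{\nu,\mu}$ is the differential operator on $\mathbb{C}^n=\mathbb{R}^{2n}$ $$\Delta_{\nu,\mu}=4\sum_{j=1}^n\frac{\partial^2}{\partial z_j\partial\bar z_j}+2i\nu(E+\overline{E}+n)+2\mu(E-\overline{E})-(\nu^2+\mu^2)|z|^2,$$ with $E=\sum_{j=1}^n z_j\frac{\partial}{\partial z_j}$ and $\overline{E}=\sum_{j=1}^n\bar z_j\frac{\partial}{\partial\bar z_j}$. The differential $1$-form $\theta_{\nu,\mu}$ on $\mathbb{C}^n$ is $$\theta_{\nu,\mu}(z)=-\frac{\mu-i\nu}{2}\sum_{j=1}^n\bar z_j\,dz_j+\frac{\mu+i\nu}{2}\sum_{j=1}^n z_j\,d\bar z_j.$$ Here $d$ is the exterior derivative on complex-valued differential forms, $(\operatorname{ext}\theta)\omega=\theta\wedge\omega$, and $(d+\operatorname{ext}\theta)^*$ denotes the formal adjoint of $d+\operatorname{ext}\theta$ with respect to the Hermitian ($L^2$) inner product on complex-valued differential $p$-forms induced by the Euclidean metric $\sum_j(dx_j^2+dy_j^2)$ on $\mathbb{C}^n=\mathbb{R}^{2n}$ ($z_j=x_j+iy_j$) and its volume form $dx_1dy_1\cdots dx_ndy_n$, i.e.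 $\langle\alpha,\beta\rangle=\int_{\mathbb{C}^n}\alpha\wedge\star\overline{\beta}$ with $\star$ the Hodge star operator extended complex-linearly. *)

theory Defs
  imports "HOL-Analysis.Analysis"
begin

text \<open>Class \<open>C\<^sup>k\<close> on the whole space: all iterated directional derivatives up to order \<open>k\<close>
  exist (as values of the total derivative) and are continuous.\<close>

primrec C_class :: "nat \<Rightarrow> ('a::euclidean_space \<Rightarrow> 'b::real_normed_vector) \<Rightarrow> bool" where
  "C_class 0 f \<longleftrightarrow> continuous_on UNIV f"
| "C_class (Suc k) f \<longleftrightarrow> (\<forall>x. f differentiable (at x)) \<and>
     (\<forall>v. C_class k (\<lambda>x. frechet_derivative f (at x) v))"

definition smooth :: "('a::euclidean_space \<Rightarrow> 'b::real_normed_vector) \<Rightarrow> bool" where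
  "smooth f \<longleftrightarrow> (\<forall>k. C_class k f)"

text \<open>A \<open>p\<close>-form \<open>\<omega>\<close> is represented by \<open>\<omega> z [v\<^sub>1, \<dots>, v\<^sub>p]\<close>, alternating and real-multilinear in the
  tangent vectors.  It is set to \<open>0\<close> on lists of length other than \<open>p\<close>, so that forms that agree
  as forms are equal as functions.\<close>

type_synonym 'a form = "'a \<Rightarrow> 'a list \<Rightarrow> complex"

definition smooth_form :: "nat \<Rightarrow> ('a::euclidean_space) form \<Rightarrow> bool" where
  "smooth_form p \<omega> \<longleftrightarrow>
     (\<forall>z vs. length vs \<noteq> p \<longrightarrow> \<omega> z vs = 0) \<and>
     (\<forall>z vs. length vs = p \<longrightarrow> (\<forall>i<p. linear (\<lambda>v. \<omega> z (vs[i := v])))) \<and>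
     (\<forall>z vs. \<not> distinct vs \<longrightarrow> \<omega> z vs = 0) \<and>
     (\<forall>vs. smooth (\<lambda>z. \<omega> z vs))"

definition compactly_supported :: "('a::euclidean_space) form \<Rightarrow> bool" where
  "compactly_supported \<omega> \<longleftrightarrow> compact (closure {z. \<exists>vs. \<omega> z vs \<noteq> 0})"

definition fun_form :: "('a \<Rightarrow> complex) \<Rightarrow> 'a form" where
  "fun_form f = (\<lambda>z vs. if vs = [] then f z else 0)"

definition omit :: "nat \<Rightarrow> 'a list \<Rightarrow> 'a list" where
  "omit i vs = take i vs @ drop (Suc i) vs"

text \<open>The invariant formula for the exterior derivative, evaluated on constant vector fields
  (whose Lie brackets vanish).\<close>

definition ext_deriv :: "('a::euclidean_space) form \<Rightarrow> 'a form" where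
  "ext_deriv \<omega> = (\<lambda>z vs. \<Sum>i<length vs.
     (-1) ^ i * frechet_derivative (\<lambda>w. \<omega> w (omit i vs)) (at z) (vs ! i))"

text \<open>Left exterior multiplication by a \<open>1\<close>-form, with the convention
  \<open>(\<alpha> \<and> \<beta>)(v, w) = \<alpha>(v) \<beta>(w) - \<alpha>(w) \<beta>(v)\<close>.\<close>

definition ext :: "'a form \<Rightarrow> 'a form \<Rightarrow> 'a form" where
  "ext \<theta> \<omega> = (\<lambda>z vs. \<Sum>i<length vs. (-1) ^ i * \<theta> z [vs ! i] * \<omega> z (omit i vs))"

definition twisted_deriv :: "('a::euclidean_space) form \<Rightarrow> 'a form \<Rightarrow> 'a form" where
  "twisted_deriv \<theta> \<omega> = (\<lambda>z vs. ext_deriv \<omega> z vs + ext \<theta> \<omega> z vs)"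

text \<open>The Hermitian inner product on \<open>p\<close>-covectors induced by the Euclidean metric, i.e. the one
  with \<open>\<alpha> \<and> \<star>(cnj \<beta>) = \<langle>\<alpha>, \<beta>\<rangle> vol\<close>.  Each \<open>p\<close>-element subset of the orthonormal basis
  occurs in \<open>p!\<close> orders, all contributing the same summand, hence the factor \<open>1 / p!\<close>.\<close>

definition covector_inner ::
    "nat \<Rightarrow> (('a::euclidean_space) list \<Rightarrow> complex) \<Rightarrow> ('a list \<Rightarrow> complex) \<Rightarrow> complex" where
  "covector_inner p \<alpha> \<beta> =
     (\<Sum>es \<in> {es. set es \<subseteq> Basis \<and> length es = p}. \<alpha> es * cnj (\<beta> es)) / fact p"

definition form_inner :: "nat \<Rightarrow> ('a::euclidean_space) form \<Rightarrow> 'a form \<Rightarrow> complex" where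
  "form_inner p \<alpha> \<beta> = (LINT z|lborel. covector_inner p (\<alpha> z) (\<beta> z))"

text \<open>The formal adjoint of an operator \<open>P\<close> from \<open>p\<close>-forms to \<open>q\<close>-forms, applied to a smooth
  \<open>q\<close>-form \<open>\<beta>\<close>.  Neither \<open>\<beta>\<close> nor the result need be square integrable: only the test forms have
  compact support.  The description is meaningful when a form \<open>\<eta>\<close> as described exists; it is then
  unique, since its pairings with all test forms are prescribed.\<close>

definition formal_adjoint ::
    "nat \<Rightarrow> nat \<Rightarrow> (('a::euclidean_space) form \<Rightarrow> 'a form) \<Rightarrow> 'a form \<Rightarrow> 'a form" where
  "formal_adjoint p q P \<beta> = (THE \<eta>. smooth_form p \<eta> \<and>
     (\<forall>\<phi>. smooth_form p \<phi> \<and> compactly_supported \<phi> \<longrightarrow>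
        form_inner q (P \<phi>) \<beta> = form_inner p \<phi> \<eta>))"

text \<open>Wirtinger derivatives: \<open>axis j 1\<close> and \<open>axis j \<i>\<close> are the directions of \<open>x\<^sub>j\<close> and \<open>y\<^sub>j\<close>
  where \<open>z\<^sub>j = x\<^sub>j + \<i> y\<^sub>j\<close>.\<close>

definition wirt :: "'n \<Rightarrow> (complex ^ 'n::finite \<Rightarrow> complex) \<Rightarrow> complex ^ 'n \<Rightarrow> complex" where
  "wirt j f = (\<lambda>z. (frechet_derivative f (at z) (axis j 1)
                    - \<i> * frechet_derivative f (at z) (axis j \<i>)) / 2)"

definition wirt_bar :: "'n \<Rightarrow> (complex ^ 'n::finite \<Rightarrow> complex) \<Rightarrow> complex ^ 'n \<Rightarrow> complex" where
  "wirt_bar j f = (\<lambda>z. (frechet_derivative f (at z) (axis j 1)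
                    + \<i> * frechet_derivative f (at z) (axis j \<i>)) / 2)"

definition euler :: "(complex ^ 'n::finite \<Rightarrow> complex) \<Rightarrow> complex ^ 'n \<Rightarrow> complex" where
  "euler f = (\<lambda>z. \<Sum>j\<in>UNIV. z $ j * wirt j f z)"

definition euler_bar :: "(complex ^ 'n::finite \<Rightarrow> complex) \<Rightarrow> complex ^ 'n \<Rightarrow> complex" where
  "euler_bar f = (\<lambda>z. \<Sum>j\<in>UNIV. cnj (z $ j) * wirt_bar j f z)"

definition Laplacian ::
    "real \<Rightarrow> real \<Rightarrow> (complex ^ 'n::finite \<Rightarrow> complex) \<Rightarrow> complex ^ 'n \<Rightarrow> complex" where
  "Laplacian \<nu> \<mu> f = (\<lambda>z.
     4 * (\<Sum>j\<in>UNIV. wirt j (wirt_bar j f) z)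
     + 2 * \<i> * of_real \<nu> * (euler f z + euler_bar f z + of_nat CARD('n) * f z)
     + 2 * of_real \<mu> * (euler f z - euler_bar f z)
     - of_real ((\<nu>\<^sup>2 + \<mu>\<^sup>2) * (norm z)\<^sup>2) * f z)"

definition dz :: "'n \<Rightarrow> (complex ^ 'n::finite) form" where
  "dz j = ext_deriv (fun_form (\<lambda>w. w $ j))"

definition dz_bar :: "'n \<Rightarrow> (complex ^ 'n::finite) form" where
  "dz_bar j = ext_deriv (fun_form (\<lambda>w. cnj (w $ j)))"

definition theta :: "real \<Rightarrow> real \<Rightarrow> (complex ^ 'n::finite) form" where
  "theta \<nu> \<mu> = (\<lambda>z vs.
     - ((of_real \<mu> - \<i> * of_real \<nu>) / 2) * (\<Sum>j\<in>UNIV. cnj (z $ j) * dz j z vs)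
     + ((of_real \<mu> + \<i> * of_real \<nu>) / 2) * (\<Sum>j\<in>UNIV. z $ j * dz_bar j z vs))"

end

theory Submission
  imports Defs
begin

text \<open>
  Write \<open>\<partial>\<^sub>e\<close> for the derivative in the direction of a vector \<open>e\<close> of the standard orthonormal basis of
  the real vector space underlying complex n-space, and \<open>\<theta>\<^sub>e\<close> for the corresponding component of
  \<open>\<theta>\<close>.  The twisted derivative maps a function \<open>u\<close> to the form with components \<open>(\<partial>\<^sub>e + \<theta>\<^sub>e) u\<close>.
  Integration by parts shows that its formal adjoint maps a form with components \<open>\<beta>\<^sub>e\<close> to the sum of
  \<open>(- \<partial>\<^sub>e + cnj \<theta>\<^sub>e) \<beta>\<^sub>e\<close> over the basis (\<open>formal_adjoint_twisted_deriv\<close>).  For the form at hand all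
  \<open>\<theta>\<^sub>e\<close> are purely imaginary, hence minus the adjoint composed with the operator is the sum of the
  squares \<open>(\<partial>\<^sub>e + \<theta>\<^sub>e)\<^sup>2\<close>, that is, of \<open>\<partial>\<^sub>e\<^sup>2 + 2 \<theta>\<^sub>e \<partial>\<^sub>e + (\<partial>\<^sub>e \<theta>\<^sub>e) + \<theta>\<^sub>e\<^sup>2\<close>.  In each coordinate
  plane these four terms are, in this order, the flat Laplacian, the two first-order terms with the
  Euler operators, the constant term \<open>2 \<i> \<nu>\<close>, and the potential
  \<open>- (\<nu>\<^sup>2 + \<mu>\<^sup>2) \<bar>z\<^sub>j\<bar>\<^sup>2\<close>.

  The adjoint is defined by a unique description, so the computation has three analytic ingredients.
  The integral of a derivative of a compactly supported smooth function vanishes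
  (\<open>integral_dir_deriv_eq_0\<close>), which yields existence.  A smooth function is determined by its
  integrals against test functions (\<open>smooth_eq_by_testing\<close>), which yields uniqueness and needs a smooth
  bump function.  Finally, mixed second derivatives commute (\<open>dir_deriv_commute\<close>), which identifies the
  Wirtinger form of the flat Laplacian with the sum of the second derivatives.
\<close>

section \<open>Closure properties of smooth functions\<close>

abbreviation (input) dir_deriv ::
    "'a::euclidean_space \<Rightarrow> ('a \<Rightarrow> 'b::real_normed_vector) \<Rightarrow> 'a \<Rightarrow> 'b" where
  "dir_deriv v f \<equiv> (\<lambda>x. frechet_derivative f (at x) v)"

lemma C_class_SucD: "C_class (Suc k) f \<Longrightarrow> C_class k f"
proof (induction k arbitrary: f)
  case 0
  then show ?case
    by (auto simp: continuous_on_eq_continuous_at intro: differentiable_imp_continuous_within)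
next
  case (Suc k)
  show ?case
    using C_class.simps(2)[THEN iffD1, OF Suc.prems] Suc.IH
    by (subst C_class.simps(2)) blast
qed

text \<open>The closure properties of the classes \<open>C\<^sup>k\<close> are inductions that use this rule: it
  replaces the Frechet derivative, a choice from the possible derivatives, by an explicit formula.\<close>

lemma C_class_SucI:
  assumes "\<And>x. (f has_derivative f' x) (at x)" and "\<And>v. C_class k (\<lambda>x. f' x v)"
  shows "C_class (Suc k) f"
proof -
  have "frechet_derivative f (at x) = f' x" for x
    using frechet_derivative_at[OF assms(1)] by simp
  then show ?thesis
    using assms by (auto simp: differentiable_def)
qed

lemma C_class_Suc_has_derivative:
  "C_class (Suc k) f \<Longrightarrow> (f has_derivative frechet_derivative f (at x)) (at x)"
  by (simp add: frechet_derivative_works)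

lemma C_class_const: "C_class k (\<lambda>x. c)"
proof (induction k arbitrary: c)
  case (Suc k)
  show ?case by (rule C_class_SucI[where f' = "\<lambda>x v. 0"]) (auto intro: Suc)
qed auto

lemma C_class_add:
  "C_class k f \<Longrightarrow> C_class k g \<Longrightarrow> C_class k (\<lambda>x. f x + g x)"
proof (induction k arbitrary: f g)
  case 0
  then show ?case by (auto intro: continuous_intros)
next
  case (Suc k)
  show ?case
    by (rule C_class_SucI[OF has_derivative_add[OF Suc.prems[THEN C_class_Suc_has_derivative]]])
       (use Suc in auto)
qed

lemma (in bounded_linear) C_class_bounded_linear:
  "C_class k g \<Longrightarrow> C_class k (\<lambda>x. f (g x))"
proof (induction k arbitrary: g)
  case 0
  then show ?case by (auto intro: continuous_on)
next
  case (Suc k)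
  show ?case
    by (rule C_class_SucI[OF has_derivative[OF C_class_Suc_has_derivative[OF Suc.prems]]])
       (use Suc in auto)
qed

lemma (in bounded_bilinear) C_class_bounded_bilinear:
  "C_class k f \<Longrightarrow> C_class k g \<Longrightarrow> C_class k (\<lambda>x. prod (f x) (g x))"
proof (induction k arbitrary: f g)
  case 0
  then show ?case by (auto intro: continuous_on)
next
  case (Suc k)
  show ?case
    by (rule C_class_SucI[OF FDERIV[OF Suc.prems[THEN C_class_Suc_has_derivative]]])
       (use Suc Suc.prems[THEN C_class_SucD] in \<open>auto intro!: C_class_add\<close>)
qed

lemma smooth_has_derivative:
  "smooth f \<Longrightarrow> (f has_derivative frechet_derivative f (at x)) (at x)"
  using C_class_Suc_has_derivative unfolding smooth_def by blast

lemma smooth_dir_deriv: "smooth f \<Longrightarrow> smooth (dir_deriv v f)"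
  unfolding smooth_def by (metis C_class.simps(2))

lemma smooth_continuous_on: "smooth f \<Longrightarrow> continuous_on S f"
  unfolding smooth_def by (metis C_class.simps(1) continuous_on_subset subset_UNIV)

lemma smooth_const: "smooth (\<lambda>x. c)"
  by (simp add: smooth_def C_class_const)

lemma smooth_add: "smooth f \<Longrightarrow> smooth g \<Longrightarrow> smooth (\<lambda>x. f x + g x)"
  by (simp add: smooth_def C_class_add)

lemma smooth_sum: "(\<And>i. i \<in> I \<Longrightarrow> smooth (f i)) \<Longrightarrow> smooth (\<lambda>x. \<Sum>i\<in>I. f i x)"
  by (induction I rule: infinite_finite_induct) (auto intro: smooth_const smooth_add)

lemma (in bounded_linear) smooth_bounded_linear: "smooth g \<Longrightarrow> smooth (\<lambda>x. f (g x))"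
  by (simp add: smooth_def C_class_bounded_linear)

lemma (in bounded_bilinear) smooth_bounded_bilinear:
  "smooth f \<Longrightarrow> smooth g \<Longrightarrow> smooth (\<lambda>x. prod (f x) (g x))"
  by (simp add: smooth_def C_class_bounded_bilinear)

lemma smooth_ident: "smooth (\<lambda>x. x)"
  unfolding smooth_def
proof
  fix k show "C_class k (\<lambda>x::'a. x)"
    by (cases k) (auto simp: C_class_const)
qed

lemmas smooth_cnj = bounded_linear.smooth_bounded_linear[OF bounded_linear_cnj]
lemmas smooth_minus = bounded_linear.smooth_bounded_linear[OF bounded_linear_minus[OF bounded_linear_ident]]
lemmas smooth_mult = bounded_bilinear.smooth_bounded_bilinear[OF bounded_bilinear_mult]
lemmas smooth_scaleR = bounded_bilinear.smooth_bounded_bilinear[OF bounded_bilinear_scaleR]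

lemma smooth_diff:
  fixes f g :: "'a::euclidean_space \<Rightarrow> 'b::real_normed_vector"
  shows "smooth f \<Longrightarrow> smooth g \<Longrightarrow> smooth (\<lambda>x. f x - g x)"
  using smooth_add[OF _ smooth_minus, of f g] by simp

lemmas smooth_intros =
  smooth_const smooth_add smooth_diff smooth_minus smooth_sum smooth_mult smooth_scaleR smooth_cnj
  smooth_dir_deriv smooth_ident

section \<open>A smooth bump function\<close>

text \<open>For \<open>k = 0\<close> this is the classical smooth function that is flat at the origin.  The powers of
  \<open>inverse t\<close> are included because they are what differentiation produces: the family is closed
  under differentiation up to linear combinations, which makes smoothness an induction.\<close>

definition flat_exp :: "nat \<Rightarrow> real \<Rightarrow> real" where
  "flat_exp k t = (if t > 0 then exp (- inverse t) * inverse t ^ k else 0)"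

lemma flat_exp_tendsto_0: "(flat_exp k \<longlongrightarrow> 0) (at 0)"
proof -
  have "((\<lambda>t. inverse t ^ k / exp (inverse t)) \<longlongrightarrow> (0::real)) (at_right 0)"
    by (rule filterlim_compose[OF tendsto_power_div_exp_0 filterlim_inverse_at_top_right])
  then have "(flat_exp k \<longlongrightarrow> 0) (at_right 0)"
    by (rule Lim_transform_eventually)
       (simp add: flat_exp_def eventually_at_filter exp_minus divide_inverse mult.commute)
  moreover have "(flat_exp k \<longlongrightarrow> 0) (at_left 0)"
    by (rule Lim_transform_eventually[OF tendsto_const])
       (auto simp: flat_exp_def eventually_at_filter)
  ultimately show ?thesis
    by (simp add: filterlim_split_at)
qed

lemma flat_exp_has_field_derivative:
  "(flat_exp k has_field_derivative flat_exp (k + 2) t - k * flat_exp (k + 1) t) (at t)"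
proof -
  consider "t > 0" | "t < 0" | "t = 0" by linarith
  then show ?thesis
  proof cases
    case 1
    have "((\<lambda>t. exp (- inverse t) * inverse t ^ k) has_field_derivative
       exp (- inverse t) * (inverse t ^ 2 * inverse t ^ k
         - k * (inverse t ^ (k - 1) * inverse t ^ 2))) (at t)"
      using 1 by (auto intro!: derivative_eq_intros simp: power2_eq_square algebra_simps)
    moreover have eq: "k * (inverse t ^ (k - 1) * inverse t ^ 2) = k * inverse t ^ (k + 1)"
      by (cases k) (simp_all add: power2_eq_square)
    have "exp (- inverse t) * (inverse t ^ 2 * inverse t ^ k
        - k * (inverse t ^ (k - 1) * inverse t ^ 2)) = flat_exp (k + 2) t - k * flat_exp (k + 1) t"
      unfolding eq using 1 by (simp add: flat_exp_def power2_eq_square algebra_simps)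
    ultimately have *: "((\<lambda>t. exp (- inverse t) * inverse t ^ k) has_field_derivative
       flat_exp (k + 2) t - k * flat_exp (k + 1) t) (at t)"
      by (simp only:)
    show ?thesis
      by (rule has_field_derivative_transform_within_open[OF *, of "{0<..}"])
         (use 1 in \<open>auto simp: flat_exp_def\<close>)
  next
    case 2
    have *: "((\<lambda>t. 0) has_field_derivative flat_exp (k + 2) t - k * flat_exp (k + 1) t) (at t)"
      using 2 by (auto simp: flat_exp_def)
    show ?thesis
      by (rule has_field_derivative_transform_within_open[OF *, of "{..<0}"])
         (use 2 in \<open>auto simp: flat_exp_def\<close>)
  next
    case 3
    have "flat_exp (k + 1) = (\<lambda>h. (flat_exp k h - flat_exp k 0) / (h - 0))"
      by (auto simp: flat_exp_def fun_eq_iff divide_inverse)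
    with flat_exp_tendsto_0[of "k + 1"] 3 show ?thesis
      by (simp add: has_field_derivative_iff) (simp add: flat_exp_def)
  qed
qed

text \<open>A formula for the higher derivatives is avoided by proving, for all \<open>k\<close> and all smooth factors \<open>p\<close>
  at once, that the products \<open>flat_exp k (q x) * p x\<close> are of class \<open>C\<^sup>m\<close>.  A directional derivative of
  such a product is a sum of products of the same kind, so that the induction on \<open>m\<close> closes.\<close>

lemma smooth_flat_exp_comp:
  assumes q: "smooth q"
  shows "smooth (\<lambda>x. flat_exp k (q x))"
proof -
  have "C_class m (\<lambda>x. flat_exp k (q x) * p x)" if "smooth p" for m k p
    using that
  proof (induction m arbitrary: k p)
    case 0
    have "continuous_on UNIV (flat_exp k)"
      by (rule DERIV_continuous_on)
         (rule has_field_derivative_at_within[OF flat_exp_has_field_derivative])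
    then show ?case
      unfolding C_class.simps
      by (intro continuous_on_mult continuous_on_compose2[OF _ smooth_continuous_on[OF q]]
            smooth_continuous_on[OF 0]) auto
  next
    case (Suc m)
    let ?d = "\<lambda>x. flat_exp (k + 2) (q x) - k * flat_exp (k + 1) (q x)"
    have q': "((\<lambda>x. flat_exp k (q x)) has_derivative (\<lambda>v. frechet_derivative q (at x) v * ?d x)) (at x)" for x
      using has_derivative_compose[OF smooth_has_derivative[OF q]
        flat_exp_has_field_derivative[unfolded has_field_derivative_def]]
      by (simp add: mult.commute)
    show ?case
    proof (rule C_class_SucI[OF has_derivative_mult[OF q' smooth_has_derivative[OF Suc.prems]]])
      fix v
      have "C_class m (\<lambda>x. flat_exp k (q x) * dir_deriv v p x
        + (flat_exp (k + 2) (q x) * (dir_deriv v q x * p x)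
        + flat_exp (k + 1) (q x) * (- of_nat k * (dir_deriv v q x * p x))))"
        by (intro C_class_add Suc.IH smooth_intros q Suc.prems)
      then show "C_class m (\<lambda>x. flat_exp k (q x) * frechet_derivative p (at x) v +
          frechet_derivative q (at x) v * ?d x * p x)"
        by (simp add: algebra_simps)
    qed
  qed
  from this[OF smooth_const[of 1]] show ?thesis by (simp add: smooth_def)
qed

definition bump :: "'a::euclidean_space \<Rightarrow> 'a \<Rightarrow> real" where
  "bump a x = flat_exp 0 (1 - (x - a) \<bullet> (x - a))"

lemma smooth_bump: "smooth (bump a)"
proof -
  have "smooth (\<lambda>x. flat_exp 0 (1 - (x - a) \<bullet> (x - a)))"
    by (intro smooth_flat_exp_comp smooth_intros
          bounded_bilinear.smooth_bounded_bilinear[OF bounded_bilinear_inner])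
  then show ?thesis by (simp add: bump_def[abs_def])
qed

lemma bump_nonneg: "bump a x \<ge> 0"
  by (simp add: bump_def flat_exp_def)

lemma bump_center_pos: "bump a a > 0"
  by (simp add: bump_def flat_exp_def)

lemma bump_eq_0:
  assumes "x \<notin> cball a 1"
  shows "bump a x = 0"
proof -
  have "1 < norm (x - a)"
    using assms by (simp add: dist_norm norm_minus_commute)
  then have "1 < (x - a) \<bullet> (x - a)"
    by (simp add: dot_square_norm one_less_power)
  then show ?thesis
    by (simp add: bump_def flat_exp_def)
qed

section \<open>Integration by parts without boundary terms\<close>

lemma integrable_continuous_compact_support:
  fixes w :: "'a::euclidean_space \<Rightarrow> 'b::{banach, second_countable_topology}"
  assumes "continuous_on UNIV w" and "\<And>x. x \<notin> cball 0 R \<Longrightarrow> w x = 0"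
  shows "integrable lborel w"
proof -
  have "(\<lambda>x. indicator (cball 0 R) x *\<^sub>R w x) = w"
    using assms(2) by (auto simp: indicator_def fun_eq_iff)
  moreover have "integrable lborel (\<lambda>x. indicator (cball 0 R) x *\<^sub>R w x)"
    using assms(1) by (intro borel_integrable_compact compact_cball) (rule continuous_on_subset, auto)
  ultimately show ?thesis by simp
qed

lemma has_derivative_along_line:
  assumes "smooth w"
  shows "((\<lambda>t. w (x + t *\<^sub>R v)) has_derivative
    (\<lambda>s. s *\<^sub>R frechet_derivative w (at (x + t *\<^sub>R v)) v)) (at t)"
proof -
  have *: "(w has_derivative frechet_derivative w (at (x + t *\<^sub>R v))) (at (x + t *\<^sub>R v))"
    by (rule smooth_has_derivative[OF assms])
  have "((\<lambda>t. x + t *\<^sub>R v) has_derivative (\<lambda>s. s *\<^sub>R v)) (at t)"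
    by (auto intro!: derivative_eq_intros)
  from has_derivative_compose[OF this *] show ?thesis
    by (simp add: linear_scale[OF has_derivative_linear[OF *]])
qed

text \<open>The Lebesgue integral is translation invariant, so every difference quotient of \<open>w\<close> in direction
  \<open>v\<close> has integral \<open>0\<close>.  By the mean value inequality these quotients are uniformly bounded, and for
  steps of length at most \<open>1\<close> they vanish outside a fixed ball, so dominated convergence carries the
  identity over to the derivative.  Applied to a product, this is integration by parts.\<close>

lemma
  fixes w :: "'a::euclidean_space \<Rightarrow> complex"
  assumes w: "smooth w" and supp: "\<And>x. x \<notin> cball 0 R \<Longrightarrow> w x = 0"
  shows integrable_dir_deriv: "integrable lborel (dir_deriv v w)"
    and integral_dir_deriv_eq_0: "(LINT x|lborel. dir_deriv v w x) = 0"
proof -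
  define h :: "nat \<Rightarrow> real" where "h n = inverse (Suc n)" for n
  define s where "s n x = inverse (h n) *\<^sub>R (w (h n *\<^sub>R v + x) - w x)" for n x
  have h: "0 < h n" "h n \<le> 1" for n
    by (simp_all add: h_def inverse_le_1_iff)
  have "compact (dir_deriv v w ` cball 0 (R + 2 * norm v))"
    by (intro compact_continuous_image smooth_continuous_on smooth_dir_deriv w compact_cball)
  \<comment> \<open>Radius \<open>R + norm v\<close> contains the supports of the quotients; the segments from its points
      to their translates stay within \<open>R + 2 * norm v\<close>.\<close>
  from compact_imp_bounded[OF this] obtain M where "M > 0"
    and M: "\<And>x. x \<in> cball 0 (R + 2 * norm v) \<Longrightarrow> norm (dir_deriv v w x) \<le> M"
    unfolding bounded_pos by auto
  have bound: "norm (s n x) \<le> M * indicator (cball 0 (R + norm v)) x" for n x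
  proof (cases "x \<in> cball 0 (R + norm v)")
    case True
    have "norm (w (x + h n *\<^sub>R v) - w (x + 0 *\<^sub>R v)) \<le> M * norm (h n - 0)"
    proof (rule differentiable_bound[where S = "{0..h n}"])
      fix t assume t: "t \<in> {0..h n}"
      show "((\<lambda>t. w (x + t *\<^sub>R v)) has_derivative
          (\<lambda>s. s *\<^sub>R frechet_derivative w (at (x + t *\<^sub>R v)) v)) (at t within {0..h n})"
        by (rule has_derivative_at_withinI[OF has_derivative_along_line[OF w]])
      have "norm (t *\<^sub>R v) \<le> 1 * norm v"
        using t h[of n] unfolding norm_scaleR by (intro mult_right_mono) auto
      then have "norm (x + t *\<^sub>R v) \<le> R + 2 * norm v"
        using True norm_triangle_ineq[of x "t *\<^sub>R v"] by simp
      then have "norm (dir_deriv v w (x + t *\<^sub>R v)) \<le> M"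
        using M by simp
      then show "onorm (\<lambda>s. s *\<^sub>R frechet_derivative w (at (x + t *\<^sub>R v)) v) \<le> M"
        using \<open>M > 0\<close> by (intro onorm_bound) (simp_all add: mult.commute[of M] mult_left_mono)
    qed (use h[of n] in auto)
    then show ?thesis
      using True h[of n]
      by (simp add: s_def add.commute inverse_eq_divide pos_divide_le_eq
            del: scaleR_right_diff_distrib)
  next
    case False
    have "norm (h n *\<^sub>R v) \<le> 1 * norm v"
      using h[of n] unfolding norm_scaleR by (intro mult_right_mono) auto
    moreover have "norm x \<le> norm (h n *\<^sub>R v + x) + norm (h n *\<^sub>R v)"
      using norm_triangle_ineq4[of "h n *\<^sub>R v + x" "h n *\<^sub>R v"] by simp
    ultimately have "h n *\<^sub>R v + x \<notin> cball 0 R" "x \<notin> cball 0 R"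
      using False norm_ge_zero[of v] unfolding mem_cball_0 by linarith+
    then show ?thesis
      using False supp by (simp add: s_def)
  qed
  have h_lim: "filterlim h (at 0) sequentially"
    unfolding filterlim_at
    using h LIMSEQ_inverse_real_of_nat by (simp add: h_def[abs_def] less_imp_neq[symmetric])
  have lim: "(\<lambda>n. s n x) \<longlonglongrightarrow> dir_deriv v w x" for x
  proof -
    have "((\<lambda>t. norm (w (x + t *\<^sub>R v) - w x - t *\<^sub>R dir_deriv v w x) / norm t) \<longlongrightarrow> 0) (at 0)"
      using has_derivative_along_line[OF w, of x v 0] by (simp add: has_derivative_at)
    from filterlim_compose[OF this h_lim]
    have "(\<lambda>n. norm (w (x + h n *\<^sub>R v) - w x - h n *\<^sub>R dir_deriv v w x) / norm (h n)) \<longlonglongrightarrow> 0" .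
    moreover have "norm (w (x + h n *\<^sub>R v) - w x - h n *\<^sub>R dir_deriv v w x) / norm (h n)
        = norm (s n x - dir_deriv v w x)" for n
    proof -
      have "s n x - dir_deriv v w x
          = inverse (h n) *\<^sub>R (w (x + h n *\<^sub>R v) - w x - h n *\<^sub>R dir_deriv v w x)"
        using h(1)[of n] by (simp add: s_def add.commute scaleR_right_diff_distrib)
      then show ?thesis using h(1)[of n] by (simp add: divide_inverse mult.commute)
    qed
    ultimately show ?thesis
      by (simp add: tendsto_norm_zero_iff LIM_zero_iff)
  qed
  have w_meas [measurable]: "w \<in> borel_measurable borel"
    by (intro borel_measurable_continuous_onI smooth_continuous_on w)
  have d_meas [measurable]: "dir_deriv v w \<in> borel_measurable borel"
    by (intro borel_measurable_continuous_onI smooth_continuous_on smooth_dir_deriv w)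
  have s_meas [measurable]: "s n \<in> borel_measurable borel" for n
    unfolding s_def by measurable
  have w_int: "integrable lborel w"
    by (rule integrable_continuous_compact_support[OF smooth_continuous_on[OF w] supp])
  have shift: "integrable lborel (\<lambda>x. w (c + x))" "(LINT x|lborel. w (c + x)) = (LINT x|lborel. w x)" for c
  proof -
    have d: "distr lborel lborel ((+) c) = (lborel :: 'a measure)"
      using lborel_distr_plus[of c] by (simp cong: distr_cong)
    show "integrable lborel (\<lambda>x. w (c + x))"
      using w_int integrable_distr[of "(+) c" lborel lborel w] by (simp add: d)
    show "(LINT x|lborel. w (c + x)) = (LINT x|lborel. w x)"
      using integral_distr[of "(+) c" lborel lborel w] by (simp add: d)
  qed
  have s_int: "(LINT x|lborel. s n x) = 0" for n
    using shift w_int by (simp add: s_def)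
  have m_int: "integrable lborel (\<lambda>x. M * indicator (cball 0 (R + norm v)) (x::'a))"
    using emeasure_bounded_finite[OF bounded_cball]
    by (intro integrable_mult_right integrable_real_indicator) simp_all
  show "integrable lborel (dir_deriv v w)"
    by (rule integrable_dominated_convergence[where s = s, OF _ _ m_int]) (use d_meas s_meas lim bound in auto)
  have "(\<lambda>n. LINT x|lborel. s n x) \<longlonglongrightarrow> (LINT x|lborel. dir_deriv v w x)"
    by (rule integral_dominated_convergence[where s = s, OF _ _ m_int]) (use d_meas s_meas lim bound in auto)
  then show "(LINT x|lborel. dir_deriv v w x) = 0"
    by (simp add: s_int LIMSEQ_const_iff)
qed

section \<open>Test functions determine a smooth function\<close>

lemma continuous_AE_lborel_eq_0:
  fixes w :: "'a::euclidean_space \<Rightarrow> 'b::real_normed_vector"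
  assumes "continuous_on UNIV w" and "AE x in lborel. w x = 0"
  shows "w x = 0"
proof -
  have "open {x. w x \<noteq> 0}"
    using assms(1) by (intro open_Collect_neq continuous_intros)
  then have "negligible {x. w x \<noteq> 0}"
    unfolding negligible_iff_null_sets
    using AE_iff_null[of lborel "\<lambda>x. w x = 0"] assms(2) borel_open[OF \<open>open {x. w x \<noteq> 0}\<close>]
    by (intro null_sets_completionI) simp
  with \<open>open {x. w x \<noteq> 0}\<close> show ?thesis
    using open_not_negligible by blast
qed

text \<open>The fundamental lemma of the calculus of variations.  Testing with the difference \<open>g - h\<close> itself, cut
  off by a bump at \<open>a\<close>, yields the integral of a nonnegative function that is positive at \<open>a\<close> unless
  \<open>g a = h a\<close>.\<close>

lemma smooth_eq_by_testing:
  fixes g h :: "'a::euclidean_space \<Rightarrow> complex"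
  assumes g: "smooth g" and h: "smooth h"
    and test: "\<And>u R. smooth u \<Longrightarrow> (\<And>x. x \<notin> cball 0 R \<Longrightarrow> u x = 0) \<Longrightarrow>
      (LINT x|lborel. u x * cnj (g x)) = (LINT x|lborel. u x * cnj (h x))"
  shows "g = h"
proof
  fix a
  define d where "d x = g x - h x" for x
  define u where "u x = bump a x *\<^sub>R d x" for x
  define w where "w x = bump a x * (norm (d x))\<^sup>2" for x
  have d: "smooth d"
    unfolding d_def[abs_def] by (intro smooth_intros g h)
  have u: "smooth u"
    unfolding u_def[abs_def] by (intro smooth_intros smooth_bump d)
  have outside: "bump a x = 0" if "x \<notin> cball 0 (norm a + 1)" for x
    using that norm_triangle_sub[of x a] by (intro bump_eq_0) (auto simp: dist_norm norm_minus_commute)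
  have int: "integrable lborel (\<lambda>x. u x * cnj (k x))" if "smooth k" for k
    by (rule integrable_continuous_compact_support[where R = "norm a + 1"])
       (intro smooth_continuous_on smooth_intros u that, simp add: u_def outside)
  have w_cont: "continuous_on UNIV w"
    unfolding w_def by (intro continuous_intros smooth_continuous_on smooth_bump d)
  have w_int: "integrable lborel w"
    by (rule integrable_continuous_compact_support[OF w_cont, where R = "norm a + 1"])
       (simp add: w_def outside)
  have "of_real (LINT x|lborel. w x) = (LINT x|lborel. complex_of_real (w x))"
    by simp
  also have "\<dots> = (LINT x|lborel. u x * cnj (g x) - u x * cnj (h x))"
  proof (intro Bochner_Integration.integral_cong refl)
    fix x
    have "complex_of_real (w x) = u x * cnj (d x)"
      unfolding w_def u_def of_real_mult complex_norm_square scaleR_conv_of_real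
      by (simp add: mult.assoc)
    then show "complex_of_real (w x) = u x * cnj (g x) - u x * cnj (h x)"
      by (simp add: d_def right_diff_distrib)
  qed
  also have "\<dots> = 0"
    using test[OF u, of "norm a + 1"]
    by (subst Bochner_Integration.integral_diff[OF int[OF g] int[OF h]]) (simp add: u_def outside)
  finally have "(LINT x|lborel. w x) = 0" by simp
  then have "AE x in lborel. w x = 0"
    using w_int by (subst (asm) integral_nonneg_eq_0_iff_AE) (auto simp: w_def bump_nonneg)
  from continuous_AE_lborel_eq_0[OF w_cont this, of a] bump_center_pos[of a]
  show "g a = h a" by (simp add: w_def d_def)
qed

section \<open>Directional derivatives\<close>

text \<open>The left-hand side is symmetric in \<open>u\<close> and \<open>v\<close>, whereas the right-hand side is a mixed second
  derivative taken in a definite order; this is what makes second derivatives commute.  The mean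
  value theorem is applied in direction \<open>u\<close> to the difference in direction \<open>v\<close>, and then in
  direction \<open>v\<close>; both steps need real values.\<close>

lemma mixed_difference_mvt:
  fixes g :: "'a::euclidean_space \<Rightarrow> real"
  assumes g: "smooth g" and t: "t > 0"
  obtains a b where "a \<in> {0..t}" "b \<in> {0..t}"
    "g (x + t *\<^sub>R u + t *\<^sub>R v) - g (x + t *\<^sub>R u) - g (x + t *\<^sub>R v) + g x
      = t\<^sup>2 * dir_deriv v (dir_deriv u g) (x + a *\<^sub>R u + b *\<^sub>R v)"
proof -
  have line: "((\<lambda>s. f (y + s *\<^sub>R w)) has_field_derivative dir_deriv w f (y + s *\<^sub>R w)) (at s)"
    if "smooth f" for f :: "'a \<Rightarrow> real" and y w s
    using has_derivative_along_line[OF that, of y w s]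
    by (simp add: has_field_derivative_def mult_commute_abs)
  have "((\<lambda>s. g ((x + t *\<^sub>R v) + s *\<^sub>R u) - g (x + s *\<^sub>R u)) has_field_derivative
      dir_deriv u g ((x + t *\<^sub>R v) + s *\<^sub>R u) - dir_deriv u g (x + s *\<^sub>R u)) (at s)" for s
    by (intro DERIV_diff line g)
  from MVT2[OF t this] obtain a where a: "0 < a" "a < t"
    and a_eq: "g (x + t *\<^sub>R v + t *\<^sub>R u) - g (x + t *\<^sub>R u) - (g (x + t *\<^sub>R v) - g x)
      = t * (dir_deriv u g (x + t *\<^sub>R v + a *\<^sub>R u) - dir_deriv u g (x + a *\<^sub>R u))"
    by auto
  have "((\<lambda>s. dir_deriv u g ((x + a *\<^sub>R u) + s *\<^sub>R v)) has_field_derivative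
      dir_deriv v (dir_deriv u g) ((x + a *\<^sub>R u) + s *\<^sub>R v)) (at s)" for s
    by (intro line smooth_dir_deriv g)
  from MVT2[OF t this] obtain b where b: "0 < b" "b < t"
    and b_eq: "dir_deriv u g (x + a *\<^sub>R u + t *\<^sub>R v) - dir_deriv u g (x + a *\<^sub>R u)
      = t * dir_deriv v (dir_deriv u g) (x + a *\<^sub>R u + b *\<^sub>R v)"
    by auto
  show ?thesis
  proof (rule that[of a b])
    show "g (x + t *\<^sub>R u + t *\<^sub>R v) - g (x + t *\<^sub>R u) - g (x + t *\<^sub>R v) + g x
        = t\<^sup>2 * dir_deriv v (dir_deriv u g) (x + a *\<^sub>R u + b *\<^sub>R v)"
      using a_eq b_eq by (simp add: add_ac power2_eq_square)
  qed (use a b in auto)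
qed

text \<open>By the mean value formula for both orders, the two mixed derivatives agree at suitable points
  arbitrarily close to \<open>x\<close>; continuity gives equality at \<open>x\<close>.\<close>

lemma dir_deriv_commute_real:
  fixes g :: "'a::euclidean_space \<Rightarrow> real"
  assumes g: "smooth g"
  shows "dir_deriv u (dir_deriv v g) x = dir_deriv v (dir_deriv u g) x"
proof -
  define h :: "nat \<Rightarrow> real" where "h n = inverse (Suc n)" for n
  have h: "h n > 0" for n by (simp add: h_def)
  have h_lim: "h \<longlonglongrightarrow> 0"
    unfolding h_def by (rule LIMSEQ_inverse_real_of_nat)
  have "\<exists>a b c d. a \<in> {0..h n} \<and> b \<in> {0..h n} \<and> c \<in> {0..h n} \<and> d \<in> {0..h n} \<and>
      dir_deriv v (dir_deriv u g) (x + a *\<^sub>R u + b *\<^sub>R v)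
      = dir_deriv u (dir_deriv v g) (x + c *\<^sub>R v + d *\<^sub>R u)" for n
  proof -
    obtain a b where ab: "a \<in> {0..h n}" "b \<in> {0..h n}"
      "g (x + h n *\<^sub>R u + h n *\<^sub>R v) - g (x + h n *\<^sub>R u) - g (x + h n *\<^sub>R v) + g x
        = (h n)\<^sup>2 * dir_deriv v (dir_deriv u g) (x + a *\<^sub>R u + b *\<^sub>R v)"
      by (rule mixed_difference_mvt[OF g h])
    obtain c d where cd: "c \<in> {0..h n}" "d \<in> {0..h n}"
      "g (x + h n *\<^sub>R v + h n *\<^sub>R u) - g (x + h n *\<^sub>R v) - g (x + h n *\<^sub>R u) + g x
        = (h n)\<^sup>2 * dir_deriv u (dir_deriv v g) (x + c *\<^sub>R v + d *\<^sub>R u)"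
      by (rule mixed_difference_mvt[OF g h])
    have "(h n)\<^sup>2 * dir_deriv v (dir_deriv u g) (x + a *\<^sub>R u + b *\<^sub>R v)
        = (h n)\<^sup>2 * dir_deriv u (dir_deriv v g) (x + c *\<^sub>R v + d *\<^sub>R u)"
      unfolding ab(3)[symmetric] cd(3)[symmetric] by (simp add: add_ac)
    with ab(1,2) cd(1,2) h[of n] show ?thesis
      by (intro exI[of _ a] exI[of _ b] exI[of _ c] exI[of _ d]) simp
  qed
  then obtain a b c d where abcd:
    "\<And>n. a n \<in> {0..h n}" "\<And>n. b n \<in> {0..h n}" "\<And>n. c n \<in> {0..h n}" "\<And>n. d n \<in> {0..h n}"
    and eq: "\<And>n. dir_deriv v (dir_deriv u g) (x + a n *\<^sub>R u + b n *\<^sub>R v)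
      = dir_deriv u (dir_deriv v g) (x + c n *\<^sub>R v + d n *\<^sub>R u)"
    by metis
  have to_0: "s \<longlonglongrightarrow> 0" if "\<And>n. s n \<in> {0..h n}" for s
    by (rule tendsto_sandwich[OF _ _ tendsto_const h_lim]) (use that in auto)
  have lim: "(\<lambda>n. dir_deriv w (dir_deriv w' g) (x + p n *\<^sub>R y + q n *\<^sub>R y'))
      \<longlonglongrightarrow> dir_deriv w (dir_deriv w' g) x"
    if "\<And>n. p n \<in> {0..h n}" "\<And>n. q n \<in> {0..h n}" for w w' y y' p q
  proof (rule isCont_tendsto_compose[of x "dir_deriv w (dir_deriv w' g)"])
    show "isCont (dir_deriv w (dir_deriv w' g)) x"
      using smooth_continuous_on[of _ UNIV, OF smooth_dir_deriv[OF smooth_dir_deriv[OF g]]]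
      by (simp add: continuous_on_eq_continuous_at)
    have "(\<lambda>n. x + p n *\<^sub>R y + q n *\<^sub>R y') \<longlonglongrightarrow> x + 0 *\<^sub>R y + 0 *\<^sub>R y'"
      by (intro tendsto_intros to_0 that)
    then show "(\<lambda>n. x + p n *\<^sub>R y + q n *\<^sub>R y') \<longlonglongrightarrow> x" by simp
  qed
  have "(\<lambda>n. dir_deriv v (dir_deriv u g) (x + a n *\<^sub>R u + b n *\<^sub>R v))
      \<longlonglongrightarrow> dir_deriv v (dir_deriv u g) x"
    by (rule lim[OF abcd(1,2)])
  moreover have "(\<lambda>n. dir_deriv v (dir_deriv u g) (x + a n *\<^sub>R u + b n *\<^sub>R v))
      \<longlonglongrightarrow> dir_deriv u (dir_deriv v g) x"
    unfolding eq by (rule lim[OF abcd(3,4)])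
  ultimately show ?thesis by (rule LIMSEQ_unique[symmetric])
qed

lemma dir_deriv_eqI: "(f has_derivative f') (at x) \<Longrightarrow> dir_deriv v f x = f' v"
  using frechet_derivative_at by metis

lemma dir_deriv_bounded_linear:
  assumes "bounded_linear h" and "smooth f"
  shows "dir_deriv v (\<lambda>x. h (f x)) x = h (dir_deriv v f x)"
  by (rule dir_deriv_eqI[OF bounded_linear.has_derivative[OF assms(1) smooth_has_derivative[OF assms(2)]]])

lemma dir_deriv_add:
  "smooth f \<Longrightarrow> smooth g \<Longrightarrow> dir_deriv v (\<lambda>x. f x + g x) x = dir_deriv v f x + dir_deriv v g x"
  by (rule dir_deriv_eqI[OF has_derivative_add[OF smooth_has_derivative smooth_has_derivative]])

lemma dir_deriv_mult:
  fixes f g :: "'a::euclidean_space \<Rightarrow> complex"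
  shows "smooth f \<Longrightarrow> smooth g \<Longrightarrow>
    dir_deriv v (\<lambda>x. f x * g x) x = f x * dir_deriv v g x + dir_deriv v f x * g x"
  by (rule dir_deriv_eqI[OF has_derivative_mult[OF smooth_has_derivative smooth_has_derivative]])

lemma dir_deriv_commute:
  fixes f :: "'a::euclidean_space \<Rightarrow> complex"
  assumes f: "smooth f"
  shows "dir_deriv u (dir_deriv v f) x = dir_deriv v (dir_deriv u f) x"
proof -
  have "h (dir_deriv u (dir_deriv v f) x) = h (dir_deriv v (dir_deriv u f) x)"
    if h: "bounded_linear h" for h :: "complex \<Rightarrow> real"
    using dir_deriv_commute_real[OF bounded_linear.smooth_bounded_linear[OF h f], where u = u and v = v and x = x]
    by (simp add: dir_deriv_bounded_linear[OF h] f smooth_dir_deriv)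
  from this[OF bounded_linear_Re] this[OF bounded_linear_Im] show ?thesis
    by (rule complex_eqI)
qed

section \<open>The formal adjoint of the twisted derivative\<close>

lemma smooth_form_0_iff: "smooth_form 0 \<eta> \<longleftrightarrow> (\<exists>g. smooth g \<and> \<eta> = fun_form g)"
proof
  assume \<eta>: "smooth_form 0 \<eta>"
  then have "\<eta> = fun_form (\<lambda>z. \<eta> z [])"
    by (auto simp: smooth_form_def fun_form_def fun_eq_iff)
  with \<eta> show "\<exists>g. smooth g \<and> \<eta> = fun_form g"
    unfolding smooth_form_def by blast
next
  assume "\<exists>g. smooth g \<and> \<eta> = fun_form g"
  then obtain g where g: "smooth g" "\<eta> = fun_form g" by blast
  have "smooth (\<lambda>z. fun_form g z vs)" for vs
    using g(1) by (cases vs) (simp_all add: fun_form_def smooth_const)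
  with g(2) show "smooth_form 0 \<eta>"
    by (auto simp: smooth_form_def fun_form_def)
qed

lemma compactly_supported_fun_form_iff:
  "compactly_supported (fun_form u) \<longleftrightarrow> (\<exists>R. \<forall>x. x \<notin> cball 0 R \<longrightarrow> u x = 0)"
proof -
  have "{z. \<exists>vs. fun_form u z vs \<noteq> 0} = {z. u z \<noteq> 0}"
    by (auto simp: fun_form_def)
  then have "compactly_supported (fun_form u) \<longleftrightarrow> bounded {z. u z \<noteq> 0}"
    by (simp add: compactly_supported_def compact_closure)
  also have "\<dots> \<longleftrightarrow> (\<exists>R. \<forall>x. x \<notin> cball 0 R \<longrightarrow> u x = 0)"
    unfolding bounded_iff by auto
  finally show ?thesis .
qed

lemma form_inner_0:
  fixes u g :: "'a::euclidean_space \<Rightarrow> complex"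
  shows "form_inner 0 (fun_form u) (fun_form g) = (LINT z|lborel. u z * cnj (g z))"
proof -
  have "{es. set es \<subseteq> (Basis :: 'a set) \<and> length es = 0} = {[]}" by auto
  then show ?thesis
    unfolding form_inner_def covector_inner_def by (simp only:) (simp add: fun_form_def)
qed

lemma form_inner_1:
  fixes \<alpha> \<beta> :: "'a::euclidean_space form"
  shows "form_inner 1 \<alpha> \<beta> = (LINT z|lborel. (\<Sum>e\<in>Basis. \<alpha> z [e] * cnj (\<beta> z [e])))"
proof -
  have "{es. set es \<subseteq> (Basis :: 'a set) \<and> length es = 1} = (\<lambda>e. [e]) ` Basis"
    by (auto simp: length_Suc_conv)
  then show ?thesis
    unfolding form_inner_def covector_inner_def
    by (simp only:) (simp add: sum.reindex inj_on_def)
qed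

lemma twisted_deriv_fun_form:
  "twisted_deriv \<theta> (fun_form u) z [e] = dir_deriv e u z + \<theta> z [e] * u z"
  by (simp add: twisted_deriv_def ext_deriv_def ext_def omit_def fun_form_def)

text \<open>Testing determines a smooth function, so the description that defines the adjoint has at most one
  solution, and exhibiting one solution computes the adjoint.\<close>

lemma formal_adjoint_eqI:
  assumes g: "smooth g"
    and adj: "\<And>u R. smooth u \<Longrightarrow> (\<And>x. x \<notin> cball 0 R \<Longrightarrow> u x = 0) \<Longrightarrow>
      form_inner q (P (fun_form u)) \<beta> = (LINT z|lborel. u z * cnj (g z))"
  shows "formal_adjoint 0 q P \<beta> = fun_form g"
  unfolding formal_adjoint_def
proof (rule the_equality)
  have "form_inner q (P \<phi>) \<beta> = form_inner 0 \<phi> (fun_form g)"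
    if \<phi>: "smooth_form 0 \<phi>" "compactly_supported \<phi>" for \<phi>
  proof -
    obtain u where u: "smooth u" "\<phi> = fun_form u"
      using \<phi>(1) unfolding smooth_form_0_iff by blast
    moreover obtain R where "\<forall>x. x \<notin> cball 0 R \<longrightarrow> u x = 0"
      using \<phi>(2) unfolding u(2) compactly_supported_fun_form_iff by blast
    ultimately show ?thesis using adj[of u R] by (simp add: form_inner_0)
  qed
  with g show "smooth_form 0 (fun_form g) \<and> (\<forall>\<phi>. smooth_form 0 \<phi> \<and> compactly_supported \<phi> \<longrightarrow>
      form_inner q (P \<phi>) \<beta> = form_inner 0 \<phi> (fun_form g))"
    by (auto simp: smooth_form_0_iff)
next
  fix \<eta>
  assume \<eta>: "smooth_form 0 \<eta> \<and> (\<forall>\<phi>. smooth_form 0 \<phi> \<and> compactly_supported \<phi> \<longrightarrow>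
      form_inner q (P \<phi>) \<beta> = form_inner 0 \<phi> \<eta>)"
  then obtain h where h: "smooth h" "\<eta> = fun_form h"
    by (auto simp: smooth_form_0_iff)
  have "h = g"
  proof (rule smooth_eq_by_testing[OF h(1) g])
    fix u :: "'a \<Rightarrow> complex" and R
    assume u: "smooth u" "\<And>x. x \<notin> cball 0 R \<Longrightarrow> u x = 0"
    then have "smooth_form 0 (fun_form u)" "compactly_supported (fun_form u)"
      unfolding smooth_form_0_iff compactly_supported_fun_form_iff by blast+
    with \<eta> have "form_inner q (P (fun_form u)) \<beta> = form_inner 0 (fun_form u) \<eta>" by blast
    with adj[OF u] show "(LINT x|lborel. u x * cnj (h x)) = (LINT x|lborel. u x * cnj (g x))"
      by (simp add: form_inner_0 h(2))
  qed
  then show "\<eta> = fun_form g" by (simp add: h(2))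
qed

text \<open>In an orthonormal frame the operator sends \<open>u\<close> to the components \<open>dir_deriv e u + \<theta>\<^sub>e u\<close>.  The
  adjoint of multiplication by \<open>\<theta>\<^sub>e\<close> is multiplication by its conjugate, and the adjoint of
  \<open>dir_deriv e\<close> is \<open>- dir_deriv e\<close> by integration by parts.\<close>

theorem formal_adjoint_twisted_deriv:
  fixes \<theta> \<beta> :: "'a::euclidean_space form"
  assumes \<theta>: "\<And>e. e \<in> Basis \<Longrightarrow> smooth (\<lambda>z. \<theta> z [e])"
    and \<beta>: "\<And>e. e \<in> Basis \<Longrightarrow> smooth (\<lambda>z. \<beta> z [e])"
  shows "formal_adjoint 0 1 (twisted_deriv \<theta>) \<beta> =
    fun_form (\<lambda>z. \<Sum>e\<in>Basis. cnj (\<theta> z [e]) * \<beta> z [e] - dir_deriv e (\<lambda>w. \<beta> w [e]) z)"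
    (is "_ = fun_form ?g")
proof (rule formal_adjoint_eqI)
  show g: "smooth ?g"
    by (intro smooth_intros \<theta> \<beta>)
  fix u :: "'a \<Rightarrow> complex" and R
  assume u: "smooth u" and supp: "\<And>x. x \<notin> cball 0 R \<Longrightarrow> u x = 0"
  let ?w = "\<lambda>e z. u z * cnj (\<beta> z [e])"
  have w: "smooth (?w e)" if "e \<in> Basis" for e
    by (intro smooth_intros u \<beta> that)
  have leibniz: "dir_deriv e (?w e) z
      = u z * cnj (dir_deriv e (\<lambda>w. \<beta> w [e]) z) + dir_deriv e u z * cnj (\<beta> z [e])"
    if "e \<in> Basis" for e z
    by (simp add: dir_deriv_mult[OF u smooth_cnj[OF \<beta>[OF that]]]
        dir_deriv_bounded_linear[OF bounded_linear_cnj \<beta>[OF that]])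
  have w_int: "integrable lborel (dir_deriv e (?w e))" "(LINT z|lborel. dir_deriv e (?w e) z) = 0"
    if "e \<in> Basis" for e
    by (rule integrable_dir_deriv[OF w[OF that], of R] integral_dir_deriv_eq_0[OF w[OF that], of R],
        simp add: supp)+
  have ug_int: "integrable lborel (\<lambda>z. u z * cnj (?g z))"
    by (rule integrable_continuous_compact_support[where R = R])
       (intro smooth_continuous_on smooth_intros u \<theta> \<beta>, simp_all add: supp)
  \<comment> \<open>The two integrands differ by a divergence, whose integral vanishes.\<close>
  have pointwise: "(\<Sum>e\<in>Basis. twisted_deriv \<theta> (fun_form u) z [e] * cnj (\<beta> z [e]))
      = (\<Sum>e\<in>Basis. dir_deriv e (?w e) z) + u z * cnj (?g z)" for z
    unfolding cnj_sum sum_distrib_left sum.distrib[symmetric]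
    by (intro sum.cong refl) (simp add: leibniz twisted_deriv_fun_form algebra_simps)
  have "form_inner 1 (twisted_deriv \<theta> (fun_form u)) \<beta>
      = (LINT z|lborel. (\<Sum>e\<in>Basis. dir_deriv e (?w e) z) + u z * cnj (?g z))"
    unfolding form_inner_1 pointwise ..
  also have "\<dots> = (\<Sum>e\<in>Basis. (LINT z|lborel. dir_deriv e (?w e) z)) + (LINT z|lborel. u z * cnj (?g z))"
    using w_int ug_int by (simp add: Bochner_Integration.integral_add Bochner_Integration.integral_sum)
  also have "\<dots> = (LINT z|lborel. u z * cnj (?g z))"
    using w_int by simp
  finally show "form_inner 1 (twisted_deriv \<theta> (fun_form u)) \<beta> = (LINT z|lborel. u z * cnj (?g z))" .
qed

text \<open>When the component \<open>\<theta>\<^sub>e\<close> is purely imaginary, the adjoint of \<open>dir_deriv e + \<theta>\<^sub>e\<close> is its negative,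
  and the composition of the two is minus the expanded square of \<open>dir_deriv e + \<theta>\<^sub>e\<close>.\<close>

lemma twisted_square_imaginary:
  fixes f :: "'a::euclidean_space \<Rightarrow> complex"
  assumes "smooth f" and "smooth (\<lambda>z. \<theta> z [e])" and "cnj (\<theta> z [e]) = - \<theta> z [e]"
  shows "cnj (\<theta> z [e]) * twisted_deriv \<theta> (fun_form f) z [e]
      - dir_deriv e (\<lambda>w. twisted_deriv \<theta> (fun_form f) w [e]) z
    = - (dir_deriv e (dir_deriv e f) z + 2 * \<theta> z [e] * dir_deriv e f z
      + (dir_deriv e (\<lambda>w. \<theta> w [e]) z + (\<theta> z [e])\<^sup>2) * f z)"
  using assms
  by (simp add: twisted_deriv_fun_form dir_deriv_add dir_deriv_mult smooth_dir_deriv smooth_mult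
      power2_eq_square algebra_simps)

section \<open>Coordinates on complex n-space\<close>

lemma has_derivative_vec_nth_at [derivative_intros]:
  "((\<lambda>z. z $ j) has_derivative (\<lambda>v. v $ j)) (at z)"
  by (rule bounded_linear_imp_has_derivative[OF bounded_linear_vec_nth])

lemma dz_eq: "dz j z [v] = v $ j"
  by (simp add: dz_def ext_deriv_def fun_form_def omit_def
      dir_deriv_eqI[OF has_derivative_vec_nth_at])

lemma dz_bar_eq: "dz_bar j z [v] = cnj (v $ j)"
  by (simp add: dz_bar_def ext_deriv_def fun_form_def omit_def
      dir_deriv_eqI[OF has_derivative_cnj[OF has_derivative_vec_nth_at]])

lemma sum_times_axis:
  fixes a :: "'n::finite \<Rightarrow> complex"
  shows "(\<Sum>k\<in>UNIV. a k * axis j c $ k) = a j * c"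
    and "(\<Sum>k\<in>UNIV. a k * cnj (axis j c $ k)) = a j * cnj c"
  by (simp_all add: axis_def if_distrib[of cnj] if_distrib[of "(*) _"] sum.delta' cong: if_cong)

text \<open>In real coordinates \<open>z\<^sub>j = x\<^sub>j + \<i> y\<^sub>j\<close> the form has the purely imaginary components
  \<open>\<i> (\<mu> y\<^sub>j + \<nu> x\<^sub>j)\<close> and \<open>\<i> (\<nu> y\<^sub>j - \<mu> x\<^sub>j)\<close>.  The terms with \<open>\<nu>\<close> are radial and produce the sum
  of the two Euler operators; those with \<open>\<mu>\<close> are rotational and produce their difference.\<close>

lemma theta_axis_1:
  "theta \<nu> \<mu> z [axis j 1] = \<i> * of_real (\<mu> * Im (z $ j) + \<nu> * Re (z $ j))"
  unfolding theta_def dz_eq dz_bar_eq sum_times_axis by (simp add: complex_eq_iff field_simps)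

lemma theta_axis_i:
  "theta \<nu> \<mu> z [axis j \<i>] = \<i> * of_real (\<nu> * Im (z $ j) - \<mu> * Re (z $ j))"
  unfolding theta_def dz_eq dz_bar_eq sum_times_axis by (simp add: complex_eq_iff field_simps)

lemma dir_deriv_theta_axis:
  "dir_deriv v (\<lambda>z. theta \<nu> \<mu> z [axis j 1]) z = \<i> * of_real (\<mu> * Im (v $ j) + \<nu> * Re (v $ j))"
  "dir_deriv v (\<lambda>z. theta \<nu> \<mu> z [axis j \<i>]) z = \<i> * of_real (\<nu> * Im (v $ j) - \<mu> * Re (v $ j))"
  unfolding theta_axis_1 theta_axis_i
  by (rule dir_deriv_eqI, (rule derivative_eq_intros refl)+, simp add: algebra_simps)+

lemma smooth_theta: "smooth (\<lambda>z. theta \<nu> \<mu> z [v])"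
  unfolding theta_def dz_eq dz_bar_eq
  by (intro smooth_intros bounded_linear.smooth_bounded_linear[OF bounded_linear_vec_nth])

lemma Basis_complex_vec: "(Basis :: (complex ^ 'n::finite) set) = (\<Union>j. {axis j 1, axis j \<i>})"
  by (auto simp: Basis_vec_def Basis_complex_def)

lemma sum_Basis_complex_vec:
  "(\<Sum>e\<in>(Basis :: (complex ^ 'n::finite) set). F e) = (\<Sum>j\<in>UNIV. F (axis j 1) + F (axis j \<i>))"
proof -
  have ne: "axis j 1 \<noteq> axis k \<i>" for j k :: 'n
    by (auto simp: axis_eq_axis complex_eq_iff)
  show ?thesis
    unfolding Basis_complex_vec
    by (subst sum.UNION_disjoint) (auto simp: ne ne[symmetric] axis_eq_axis)
qed

lemma norm_complex_vec_square:
  "(norm z)\<^sup>2 = (\<Sum>j\<in>UNIV. (Re (z $ j))\<^sup>2 + (Im (z $ j))\<^sup>2)" for z :: "complex ^ 'n::finite"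
  unfolding power2_norm_eq_inner inner_vec_def inner_complex_def
  by (simp add: power2_eq_square)

lemma dir_deriv_wirt_bar:
  assumes f: "smooth f"
  shows "dir_deriv v (wirt_bar j f) z =
    (dir_deriv v (dir_deriv (axis j 1) f) z + \<i> * dir_deriv v (dir_deriv (axis j \<i>) f) z) / 2"
proof -
  have "((\<lambda>z. (dir_deriv (axis j 1) f z + \<i> * dir_deriv (axis j \<i>) f z) / 2) has_derivative
     (\<lambda>v. (dir_deriv v (dir_deriv (axis j 1) f) z + \<i> * dir_deriv v (dir_deriv (axis j \<i>) f) z) / 2)) (at z)"
    by (auto intro!: derivative_eq_intros smooth_has_derivative smooth_dir_deriv f)
  then show ?thesis
    unfolding wirt_bar_def by (rule dir_deriv_eqI)
qed

text \<open>The imaginary cross terms cancel because second derivatives commute.\<close>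

lemma wirt_wirt_bar:
  assumes f: "smooth f"
  shows "4 * wirt j (wirt_bar j f) z = dir_deriv (axis j 1) (dir_deriv (axis j 1) f) z
    + dir_deriv (axis j \<i>) (dir_deriv (axis j \<i>) f) z"
  unfolding wirt_def dir_deriv_wirt_bar[OF f]
    dir_deriv_commute[OF f, where u = "axis j \<i>" and v = "axis j 1"]
  by (simp add: field_simps)

lemma Laplacian_eq_sum:
  "Laplacian \<nu> \<mu> f z = (\<Sum>j\<in>UNIV. 4 * wirt j (wirt_bar j f) z
      + 2 * \<i> * of_real \<nu> * (z $ j * wirt j f z + cnj (z $ j) * wirt_bar j f z + f z)
      + 2 * of_real \<mu> * (z $ j * wirt j f z - cnj (z $ j) * wirt_bar j f z)
      - of_real ((\<nu>\<^sup>2 + \<mu>\<^sup>2) * ((Re (z $ j))\<^sup>2 + (Im (z $ j))\<^sup>2)) * f z)"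
  unfolding sum_subtractf sum.distrib sum_distrib_left[symmetric] sum_distrib_right[symmetric]
    of_real_sum[symmetric] norm_complex_vec_square[unfolded sum.distrib, symmetric]
  by (simp add: Laplacian_def euler_def euler_bar_def)

theorem proposition4p1:
  fixes \<nu> \<mu> :: real and f :: "complex ^ 'n::finite \<Rightarrow> complex"
  assumes "\<mu> > 0" and "smooth f"
  shows "fun_form (Laplacian \<nu> \<mu> f) =
    (\<lambda>z vs. - formal_adjoint 0 1 (twisted_deriv (theta \<nu> \<mu>))
                (twisted_deriv (theta \<nu> \<mu>) (fun_form f)) z vs)"
proof -
  let ?\<theta> = "theta \<nu> \<mu> :: (complex ^ 'n) form"
  let ?T = "\<lambda>z e. dir_deriv e (dir_deriv e f) z + 2 * ?\<theta> z [e] * dir_deriv e f z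
      + (dir_deriv e (\<lambda>w. ?\<theta> w [e]) z + (?\<theta> z [e])\<^sup>2) * f z"
  have f: "smooth f" by fact
  have \<beta>: "smooth (\<lambda>z. twisted_deriv ?\<theta> (fun_form f) z [e])" for e
    unfolding twisted_deriv_fun_form by (intro smooth_intros smooth_theta f)
  have cnj_theta: "cnj (?\<theta> z [e]) = - ?\<theta> z [e]" if "e \<in> Basis" for z e
    using that by (auto simp: Basis_complex_vec theta_axis_1 theta_axis_i)
  have "formal_adjoint 0 1 (twisted_deriv ?\<theta>) (twisted_deriv ?\<theta> (fun_form f))
      = fun_form (\<lambda>z. - (\<Sum>e\<in>Basis. ?T z e))"
    unfolding sum_negf[symmetric]
      formal_adjoint_twisted_deriv[of ?\<theta> "twisted_deriv ?\<theta> (fun_form f)", OF smooth_theta \<beta>]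
    by (intro arg_cong[where f = fun_form] ext sum.cong refl twisted_square_imaginary f smooth_theta
          cnj_theta)
  moreover have "Laplacian \<nu> \<mu> f = (\<lambda>z. \<Sum>e\<in>Basis. ?T z e)"
  proof
    fix z
    show "Laplacian \<nu> \<mu> f z = (\<Sum>e\<in>Basis. ?T z e)"
      unfolding Laplacian_eq_sum sum_Basis_complex_vec
    proof (intro sum.cong refl)
      fix j
      define x y where "x = Re (z $ j)" and "y = Im (z $ j)"
      have z: "z $ j = of_real x + \<i> * of_real y"
        by (simp add: x_def y_def complex_eq_iff)
      have i3: "\<i> * (\<i> * c) = - c" for c
        by (simp add: mult.assoc[symmetric])
      show "4 * wirt j (wirt_bar j f) z
        + 2 * \<i> * of_real \<nu> * (z $ j * wirt j f z + cnj (z $ j) * wirt_bar j f z + f z)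
        + 2 * of_real \<mu> * (z $ j * wirt j f z - cnj (z $ j) * wirt_bar j f z)
        - of_real ((\<nu>\<^sup>2 + \<mu>\<^sup>2) * ((Re (z $ j))\<^sup>2 + (Im (z $ j))\<^sup>2)) * f z
        = ?T z (axis j 1) + ?T z (axis j \<i>)"
        unfolding wirt_wirt_bar[OF f] dir_deriv_theta_axis
        unfolding theta_axis_1 theta_axis_i x_def[symmetric] y_def[symmetric]
        unfolding z wirt_def wirt_bar_def
        by (simp add: axis_def power2_eq_square i3 field_simps)
    qed
  qed
  ultimately show ?thesis
    by (simp only: fun_form_def fun_eq_iff if_distrib[of uminus] minus_minus minus_zero simp_thms)
qed

end
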